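(* Let $n\ge 2$, let $\alpha=(\alpha_1,\ldots,\alpha_n)$ with all $\alpha_i>0$, and let $X=(X_1,\ldots,X_n)\sim\mathrm{Dir}(\alpha)$. Then the random vector of ratios $$Y=\left(\frac{X_1}{X_n},\ldots,\frac{X_{n-1}}{X_n}\right)$$ has, with respect to Lebesgue measure on $\mathbb{R}_{+}^{n-1}=(0,\infty)^{n-1}$, the probability density $$f_Y(y)=\frac{1}{B(\alpha)}\left(\prod_{i=1}^{n-1}y_i^{\alpha_i-1}\right)\left(1+\sum_{i=1}^{n-1}y_i\right)^{-\sum_{i=1}^{n}\alpha_i},\qquad y=(y_1,\ldots,y_{n-1})\in\mathbb{R}_{+}^{n-1},$$ that is, $Y$ has the inverted Dirichlet distribution.
   Context: For $\alpha=(\alpha_1,\ldots,\alpha_n)$ with positive entries, $B(\alpha)=\frac{\prod_{i=1}^{n}\Gamma(\alpha_i)}{\Gamma(\sum_{i=1}^{n}\alpha_i)}$. The Dirichlet distribution $\mathrm{Dir}(\alpha)$ is the distribution of a random vector $X=(X_1,\ldots,X_n)$ with all components in $(0,1)$ and $\sum_{i=1}^n X_i=1$, such that $(X_1,\ldots,X_{n-1})$ has density $\frac{1}{B(\alpha)}\prod_{i=1}^{n}x_i^{\alpha_i-1}$, where $x_n=1-\sum_{i=1}^{n-1}x_i$, with respect to Lebesgue measure on $\{(x_1,\ldots,x_{n-1}): x_i>0,\ \sum_{i=1}^{n-1}x_i<1\}$. *)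

theory Defs
  imports "HOL-Probability.Probability"
begin

text \<open>
  Vectors in $\mathbb{R}^n$ are functions \<open>nat \<Rightarrow> real\<close> read on the index set \<open>{1..n}\<close>.  Lebesgue
  measure on $\mathbb{R}^m$ is the product measure \<open>\<Pi>\<^sub>M i\<in>{1..m}. lborel\<close>, whose points are the
  functions that are \<open>undefined\<close> outside \<open>{1..m}\<close>; hence the \<open>restrict\<close> in random vectors below.
  A density with respect to Lebesgue measure on a region of $\mathbb{R}^m$ is given as a density
  on $\mathbb{R}^m$ that vanishes off the region.
\<close>

definition multi_Beta :: "nat \<Rightarrow> (nat \<Rightarrow> real) \<Rightarrow> real" where
  "multi_Beta n \<alpha> = (\<Prod>i=1..n. Gamma (\<alpha> i)) / Gamma (\<Sum>i=1..n. \<alpha> i)"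

definition open_simplex :: "nat \<Rightarrow> (nat \<Rightarrow> real) set" where
  "open_simplex m = {x. (\<forall>i\<in>{1..m}. 0 < x i) \<and> (\<Sum>i=1..m. x i) < 1}"

definition positive_orthant :: "nat \<Rightarrow> (nat \<Rightarrow> real) set" where
  "positive_orthant m = {y. \<forall>i\<in>{1..m}. 0 < y i}"

text \<open>
  The argument \<open>x\<close> carries the coordinates \<open>1, \<dots>, n - 1\<close>; the update supplies
  $x_n = 1 - \sum_{i<n} x_i$.
\<close>

definition dirichlet_density :: "nat \<Rightarrow> (nat \<Rightarrow> real) \<Rightarrow> (nat \<Rightarrow> real) \<Rightarrow> real" where
  "dirichlet_density n \<alpha> x =
     (let x' = x(n := 1 - (\<Sum>i=1..n-1. x i))
      in 1 / multi_Beta n \<alpha> * (\<Prod>i=1..n. x' i powr (\<alpha> i - 1))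
         * indicator (open_simplex (n - 1)) x)"

definition inverted_dirichlet_density :: "nat \<Rightarrow> (nat \<Rightarrow> real) \<Rightarrow> (nat \<Rightarrow> real) \<Rightarrow> real" where
  "inverted_dirichlet_density n \<alpha> y =
     1 / multi_Beta n \<alpha> * (\<Prod>i=1..n-1. y i powr (\<alpha> i - 1))
       * (1 + (\<Sum>i=1..n-1. y i)) powr (- (\<Sum>i=1..n. \<alpha> i))
       * indicator (positive_orthant (n - 1)) y"

text \<open>
  Being Dirichlet distributed is a property of the law of \<open>X\<close>, so the constraints on the
  components are required almost surely only.
\<close>

definition dirichlet_distributed ::
  "'a measure \<Rightarrow> nat \<Rightarrow> (nat \<Rightarrow> real) \<Rightarrow> (nat \<Rightarrow> 'a \<Rightarrow> real) \<Rightarrow> bool" where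
  "dirichlet_distributed M n \<alpha> X \<longleftrightarrow>
     (\<forall>i\<in>{1..n}. X i \<in> borel_measurable M) \<and>
     (AE \<omega> in M. (\<forall>i\<in>{1..n}. X i \<omega> \<in> {0<..<1}) \<and> (\<Sum>i=1..n. X i \<omega>) = 1) \<and>
     distributed M (\<Pi>\<^sub>M i\<in>{1..n-1}. lborel) (\<lambda>\<omega>. \<lambda>i\<in>{1..n-1}. X i \<omega>)
       (\<lambda>x. ennreal (dirichlet_density n \<alpha> x))"

definition inverted_dirichlet_distributed ::
  "'a measure \<Rightarrow> nat \<Rightarrow> (nat \<Rightarrow> real) \<Rightarrow> (nat \<Rightarrow> 'a \<Rightarrow> real) \<Rightarrow> bool" where
  "inverted_dirichlet_distributed M n \<alpha> Y \<longleftrightarrow>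
     distributed M (\<Pi>\<^sub>M i\<in>{1..n-1}. lborel) (\<lambda>\<omega>. \<lambda>i\<in>{1..n-1}. Y i \<omega>)
       (\<lambda>y. ennreal (inverted_dirichlet_density n \<alpha> y))"

end

(*
The change of variables y = x / (1 - sum x) needs no Jacobian.  With m coordinates, integrate
F(z, t) = h(z / (t + sum z)) * 1[t + sum z < 1] over the positive orthant in two ways.
Rescaling z = t y for fixed t and then t for fixed y gives K times the integral of
h(y / (1 + sum y)) * (1 + sum y)^-(m+1) over the orthant; translating t = r - sum z and then
rescaling z = r x gives K times the integral of h over the open simplex.  Here
K = \<integral> t^m dt over (0, 1) in both cases, so it cancels.  Only Tonelli and one-dimensional affine
substitutions are used.
*)

theory Submission
  imports Defs
begin

text \<open>Induction on \<open>I\<close> peels off one coordinate at a time, and each coordinate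
  contributes one factor \<open>r\<close> through the one-dimensional affine substitution. The
  powers \<open>t ^ m\<close> and \<open>r ^ m\<close> below arise from this.\<close>

lemma nn_integral_PiM_lborel_scale:
  fixes f :: "('i \<Rightarrow> real) \<Rightarrow> ennreal"
  assumes I: "finite I" and r: "0 < r"
  assumes f[measurable]: "f \<in> borel_measurable (\<Pi>\<^sub>M i\<in>I. lborel)"
  shows "(\<integral>\<^sup>+x. f x \<partial>(\<Pi>\<^sub>M i\<in>I. lborel))
    = ennreal (r ^ card I) * (\<integral>\<^sup>+x. f (\<lambda>i\<in>I. r * x i) \<partial>(\<Pi>\<^sub>M i\<in>I. lborel))"
  using I f
proof (induction I arbitrary: f rule: finite_induct)
  case empty
  interpret product_sigma_finite "\<lambda>_. lborel :: real measure" ..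
  show ?case by (simp add: nn_integral_empty restrict_def space_PiM_empty emeasure_PiM_empty)
next
  case (insert j I f)
  interpret product_sigma_finite "\<lambda>_. lborel :: real measure" ..
  note [measurable] = insert.prems
  have *: "(\<lambda>i\<in>insert j I. r * (x(j := y)) i) = (\<lambda>i\<in>I. r * x i)(j := r * y)" for x y
    using insert.hyps by (auto simp: fun_eq_iff)
  have "(\<integral>\<^sup>+x. f x \<partial>(\<Pi>\<^sub>M i\<in>insert j I. lborel))
      = (\<integral>\<^sup>+x. (\<integral>\<^sup>+y. f (x(j := y)) \<partial>lborel) \<partial>(\<Pi>\<^sub>M i\<in>I. lborel))"
    by (intro product_nn_integral_insert insert)
  \<comment> \<open>The induction hypothesis is applied to the partial integral over coordinate
    \<open>j\<close>, hence the generalisation over \<open>f\<close>.\<close>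
  also have "\<dots> = ennreal (r ^ card I)
      * (\<integral>\<^sup>+x. (\<integral>\<^sup>+y. f ((\<lambda>i\<in>I. r * x i)(j := y)) \<partial>lborel) \<partial>(\<Pi>\<^sub>M i\<in>I. lborel))"
    by (intro insert.IH) measurable
  also have "\<dots> = ennreal (r ^ card I)
      * (\<integral>\<^sup>+x. ennreal r * (\<integral>\<^sup>+y. f ((\<lambda>i\<in>I. r * x i)(j := r * y)) \<partial>lborel) \<partial>(\<Pi>\<^sub>M i\<in>I. lborel))"
  proof (intro arg_cong2[where f="(*)"] refl nn_integral_cong)
    fix x :: "'i \<Rightarrow> real" assume x: "x \<in> space (\<Pi>\<^sub>M i\<in>I. lborel)"
    \<comment> \<open>Measurability of the section in \<open>y\<close> follows from that of
      \<open>f\<close> once the fixed point is known to lie in the product space.\<close>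
    have "(\<lambda>i\<in>I. r * x i) \<in> space (\<Pi>\<^sub>M i\<in>I. lborel)"
      by (auto simp: space_PiM)
    then have "(\<lambda>y. f ((\<lambda>i\<in>I. r * x i)(j := y))) \<in> borel_measurable borel"
      by measurable
    then show "(\<integral>\<^sup>+y. f ((\<lambda>i\<in>I. r * x i)(j := y)) \<partial>lborel)
      = ennreal r * (\<integral>\<^sup>+y. f ((\<lambda>i\<in>I. r * x i)(j := r * y)) \<partial>lborel)"
      using r nn_integral_real_affine[of "\<lambda>y. f ((\<lambda>i\<in>I. r * x i)(j := y))" r 0]
      by (simp only: add_0_left abs_of_pos)
  qed
  also have "\<dots> = ennreal (r ^ card I) * (ennreal r
      * (\<integral>\<^sup>+x. (\<integral>\<^sup>+y. f ((\<lambda>i\<in>I. r * x i)(j := r * y)) \<partial>lborel) \<partial>(\<Pi>\<^sub>M i\<in>I. lborel)))"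
    by (intro arg_cong2[where f="(*)"] refl nn_integral_cmult) measurable
  also have "\<dots> = ennreal (r ^ card (insert j I))
      * (\<integral>\<^sup>+x. (\<integral>\<^sup>+y. f ((\<lambda>i\<in>I. r * x i)(j := r * y)) \<partial>lborel) \<partial>(\<Pi>\<^sub>M i\<in>I. lborel))"
    using r insert.hyps by (simp add: ennreal_mult mult_ac)
  also have "\<dots> = ennreal (r ^ card (insert j I))
      * (\<integral>\<^sup>+x. f (\<lambda>i\<in>insert j I. r * x i) \<partial>(\<Pi>\<^sub>M i\<in>insert j I. lborel))"
    by (subst product_nn_integral_insert[OF insert.hyps]) (measurable, simp only: * )
  finally show ?case .
qed
text \<open>The weight is the Jacobian determinant of y |-> y / (1 + sum y), which maps the orthant
  onto the simplex. Of its exponent, \<open>card I\<close> comes from scaling the coordinates and 1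
  from the auxiliary variable \<open>t\<close>. Since \<open>h\<close> is arbitrary, it can later
  hold a density together with an event.\<close>

lemma nn_integral_simplex_eq_orthant:
  fixes h :: "('i \<Rightarrow> real) \<Rightarrow> ennreal"
  assumes I: "finite I"
  assumes h[measurable]: "h \<in> borel_measurable (\<Pi>\<^sub>M i\<in>I. lborel)"
  shows "(\<integral>\<^sup>+x. (if (\<forall>i\<in>I. 0 < x i) \<and> sum x I < 1 then h x else 0) \<partial>(\<Pi>\<^sub>M i\<in>I. lborel))
    = (\<integral>\<^sup>+y. (if \<forall>i\<in>I. 0 < y i
          then h (\<lambda>i\<in>I. y i / (1 + sum y I)) * ennreal (1 / (1 + sum y I) ^ (card I + 1)) else 0)
        \<partial>(\<Pi>\<^sub>M i\<in>I. lborel))"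
    (is "?S = ?O")
proof -
  let ?P = "\<Pi>\<^sub>M i\<in>I. lborel :: real measure"
  interpret product_sigma_finite "\<lambda>_. lborel :: real measure" ..
  interpret P: sigma_finite_measure ?P using I by (rule sigma_finite)
  interpret PL: pair_sigma_finite ?P "lborel :: real measure" ..
  define m where "m = card I"
  \<comment> \<open>The value is 1 / (m + 1), but only 0 < K < infinity matters: both bounds are
    what cancelling \<open>K\<close> in \<open>ennreal\<close> requires.\<close>
  define K where "K = (\<integral>\<^sup>+t. (if 0 < t \<and> t < 1 then ennreal (t ^ m) else 0) \<partial>(lborel :: real measure))"
  \<comment> \<open>The argument of \<open>h\<close> is unchanged when z and t are scaled jointly,
    so a rescaling acts on the cutoff alone. The cutoff bounds the total t + sum z by 1, which keeps
    the factor \<open>K\<close> finite.\<close>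
  define F where "F z t = (if (\<forall>i\<in>I. 0 < z i) \<and> 0 < t \<and> t + sum z I < 1
      then h (\<lambda>i\<in>I. z i / (t + sum z I)) else 0)" for z :: "'i \<Rightarrow> real" and t :: real
  define J where "J = (\<integral>\<^sup>+t. \<integral>\<^sup>+z. F z t \<partial>?P \<partial>lborel)"
  have [measurable]: "(\<lambda>(z, t). F z t) \<in> borel_measurable (?P \<Otimes>\<^sub>M lborel)"
    unfolding F_def using I by measurable

  \<comment> \<open>Joint measurability after the translation, for the second exchange of
    integrals.\<close>
  have F_shift: "(\<lambda>(z, r). F z (r - sum z I)) \<in> borel_measurable (?P \<Otimes>\<^sub>M lborel)"
    unfolding F_def using I by measurable

  have "K \<le> (\<integral>\<^sup>+t. indicator {0..1} t \<partial>(lborel :: real measure))"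
    unfolding K_def by (intro nn_integral_mono) (auto simp: indicator_def power_le_one)
  then have K_finite: "K \<noteq> \<infinity>" by (auto simp: top_unique)
  \<comment> \<open>If \<open>K\<close> were 0, the integrand would vanish almost everywhere; as t ^
    m is positive on (0, 1), that interval would be a null set.\<close>
  have "K \<noteq> 0"
  proof
    assume "K = 0"
    then have "AE t in (lborel :: real measure). (if 0 < t \<and> t < 1 then ennreal (t ^ m) else 0) = 0"
      unfolding K_def by (subst (asm) nn_integral_0_iff_AE) auto
    then have "AE t in (lborel :: real measure). t \<notin> {0<..<1}"
      by eventually_elim (auto split: if_splits simp: ennreal_eq_0_iff dest: zero_less_power[of _ m])
    moreover have "{t::real. \<not> t \<notin> {0<..<1}} = {0<..<1}" by auto
    ultimately have "emeasure lborel {0<..<1::real} = 0"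
      using AE_iff_measurable[of "{0<..<1}" lborel "\<lambda>t::real. t \<notin> {0<..<1}"] by simp
    then show False by simp
  qed

  \<comment> \<open>Substitution z = t y for fixed t > 0: t drops out of the argument of
    \<open>h\<close> and survives only in the cutoff and in t ^ m. For t at most 0 both integrands
    are 0.\<close>
  have "(\<integral>\<^sup>+z. F z t \<partial>?P)
      = (\<integral>\<^sup>+y. (if (\<forall>i\<in>I. 0 < y i) \<and> 0 < t \<and> t * (1 + sum y I) < 1
          then h (\<lambda>i\<in>I. y i / (1 + sum y I)) * ennreal (t ^ m) else 0) \<partial>?P)" for t
  proof (cases "0 < t")
    case True
    have *: "F (\<lambda>i\<in>I. t * y i) t = (if (\<forall>i\<in>I. 0 < y i) \<and> t * (1 + sum y I) < 1
          then h (\<lambda>i\<in>I. y i / (1 + sum y I)) else 0)" for y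
    proof -
      have [simp]: "t + t * sum y I = t * (1 + sum y I)" by (simp add: algebra_simps)
      have "(\<lambda>i\<in>I. (if i \<in> I then t * y i else undefined) / (t * (1 + sum y I)))
          = (\<lambda>i\<in>I. y i / (1 + sum y I))"
        using True by (auto simp: fun_eq_iff)
      then show ?thesis
        using True by (auto simp: F_def zero_less_mult_iff restrict_def simp flip: sum_distrib_left)
    qed
    have "(\<integral>\<^sup>+z. F z t \<partial>?P) = ennreal (t ^ m) * (\<integral>\<^sup>+y. F (\<lambda>i\<in>I. t * y i) t \<partial>?P)"
      unfolding m_def using I True by (intro nn_integral_PiM_lborel_scale) auto
    also have "\<dots> = (\<integral>\<^sup>+y. ennreal (t ^ m) * F (\<lambda>i\<in>I. t * y i) t \<partial>?P)"
      by (intro nn_integral_cmult[symmetric]) measurable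
    also have "\<dots> = (\<integral>\<^sup>+y. (if (\<forall>i\<in>I. 0 < y i) \<and> 0 < t \<and> t * (1 + sum y I) < 1
          then h (\<lambda>i\<in>I. y i / (1 + sum y I)) * ennreal (t ^ m) else 0) \<partial>?P)"
      using True by (intro nn_integral_cong) (auto simp: * mult.commute)
    finally show ?thesis .
  qed (simp add: F_def)
  then have "J = (\<integral>\<^sup>+t. \<integral>\<^sup>+y. (if (\<forall>i\<in>I. 0 < y i) \<and> 0 < t \<and> t * (1 + sum y I) < 1
          then h (\<lambda>i\<in>I. y i / (1 + sum y I)) * ennreal (t ^ m) else 0) \<partial>?P \<partial>lborel)"
    by (simp add: J_def)
  also have "\<dots> = (\<integral>\<^sup>+y. \<integral>\<^sup>+t. (if (\<forall>i\<in>I. 0 < y i) \<and> 0 < t \<and> t * (1 + sum y I) < 1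
          then h (\<lambda>i\<in>I. y i / (1 + sum y I)) * ennreal (t ^ m) else 0) \<partial>lborel \<partial>?P)"
    using I by (intro PL.Fubini') measurable
  also have "\<dots> = (\<integral>\<^sup>+y. (if \<forall>i\<in>I. 0 < y i
          then h (\<lambda>i\<in>I. y i / (1 + sum y I)) * ennreal (1 / (1 + sum y I) ^ (card I + 1)) else 0) * K
        \<partial>?P)"
  proof (intro nn_integral_cong)
    fix y :: "'i \<Rightarrow> real"
    let ?h = "h (\<lambda>i\<in>I. y i / (1 + sum y I))" and ?c = "1 / (1 + sum y I)"
    show "(\<integral>\<^sup>+t. (if (\<forall>i\<in>I. 0 < y i) \<and> 0 < t \<and> t * (1 + sum y I) < 1
          then ?h * ennreal (t ^ m) else 0) \<partial>lborel)
      = (if \<forall>i\<in>I. 0 < y i then ?h * ennreal (1 / (1 + sum y I) ^ (card I + 1)) else 0) * K"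
    proof (cases "\<forall>i\<in>I. 0 < y i")
      case True
      then have "0 \<le> sum y I" by (intro sum_nonneg) (auto intro: less_imp_le)
      then have s: "0 < 1 + sum y I" by simp
      have "(\<integral>\<^sup>+t. (if (\<forall>i\<in>I. 0 < y i) \<and> 0 < t \<and> t * (1 + sum y I) < 1
          then ?h * ennreal (t ^ m) else 0) \<partial>lborel)
        = (\<integral>\<^sup>+t. ?h * (if 0 < t \<and> t * (1 + sum y I) < 1 then ennreal (t ^ m) else 0) \<partial>lborel)"
        using True by (intro nn_integral_cong) auto
      also have "\<dots> = ?h * (\<integral>\<^sup>+t. (if 0 < t \<and> t * (1 + sum y I) < 1 then ennreal (t ^ m) else 0) \<partial>lborel)"
        by (intro nn_integral_cmult) measurable
      \<comment> \<open>With t = u / (1 + sum y) the range of u is (0, 1). The substitution gives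
        one factor \<open>?c\<close> and the integrand gives \<open>?c ^ m\<close>, hence the
        exponent m + 1.\<close>
      also have "(\<integral>\<^sup>+t. (if 0 < t \<and> t * (1 + sum y I) < 1 then ennreal (t ^ m) else 0) \<partial>lborel)
        = ennreal ?c * (\<integral>\<^sup>+u. (if 0 < ?c * u \<and> ?c * u * (1 + sum y I) < 1
            then ennreal ((?c * u) ^ m) else 0) \<partial>lborel)"
        using s nn_integral_real_affine[of "\<lambda>t. if 0 < t \<and> t * (1 + sum y I) < 1 then ennreal (t ^ m) else 0" ?c 0]
        by (simp cong: if_cong)
      also have "\<dots> = ennreal ?c * (\<integral>\<^sup>+u. ennreal (?c ^ m) * (if 0 < u \<and> u < 1
            then ennreal (u ^ m) else 0) \<partial>lborel)"
        using s by (intro arg_cong2[where f="(*)"] refl nn_integral_cong)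
          (auto simp: zero_less_divide_iff power_divide simp flip: ennreal_mult)
      also have "\<dots> = ennreal ?c * (ennreal (?c ^ m) * K)"
        unfolding K_def by (subst nn_integral_cmult) auto
      also have "\<dots> = ennreal (1 / (1 + sum y I) ^ (card I + 1)) * K"
        using s by (simp add: m_def power_divide mult.assoc[symmetric] flip: ennreal_mult)
      finally show ?thesis
        using True by (simp add: mult.assoc restrict_def)
    next
      case False
      then show ?thesis by (simp only: if_False simp_thms nn_integral_const) simp
    qed
  qed
  also have "\<dots> = ?O * K"
    using I by (intro nn_integral_multc) measurable
  finally have J_orthant: "J = ?O * K" .

  have "J = (\<integral>\<^sup>+z. \<integral>\<^sup>+t. F z t \<partial>lborel \<partial>?P)"
    unfolding J_def by (intro PL.Fubini') measurable
  \<comment> \<open>Translation for fixed z; the new variable r is the total t + sum z.\<close>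
  also have "\<dots> = (\<integral>\<^sup>+z. \<integral>\<^sup>+r. F z (r - sum z I) \<partial>lborel \<partial>?P)"
  proof (rule nn_integral_cong)
    fix z :: "'i \<Rightarrow> real" assume z: "z \<in> space ?P"
    then have "F z \<in> borel_measurable borel" by measurable
    then show "integral\<^sup>N lborel (F z) = (\<integral>\<^sup>+r. F z (r - sum z I) \<partial>lborel)"
      using nn_integral_real_affine[of "F z" 1 "- sum z I"] by simp
  qed
  also have "\<dots> = (\<integral>\<^sup>+r. \<integral>\<^sup>+z. F z (r - sum z I) \<partial>?P \<partial>lborel)"
    by (intro PL.Fubini'[symmetric] F_shift)
  also have "\<dots> = (\<integral>\<^sup>+r. ?S * (if 0 < r \<and> r < 1 then ennreal (r ^ m) else 0) \<partial>lborel)"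
  proof (intro nn_integral_cong)
    fix r :: real
    show "(\<integral>\<^sup>+z. F z (r - sum z I) \<partial>?P) = ?S * (if 0 < r \<and> r < 1 then ennreal (r ^ m) else 0)"
    proof (cases "0 < r")
      case True
      \<comment> \<open>After z = r x the condition 0 < t becomes sum x < 1 and the cutoff becomes r
        < 1, so the integrand splits into a function of r times a function of x. Membership in the
        space is used to identify \<open>restrict x I\<close> with x.\<close>
      have *: "F (\<lambda>i\<in>I. r * x i) (r - (\<Sum>j\<in>I. r * x j))
          = (if r < 1 then 1 else 0) * (if (\<forall>i\<in>I. 0 < x i) \<and> sum x I < 1 then h x else 0)"
        if x: "x \<in> space ?P" for x
      proof -
        have "(\<lambda>i\<in>I. (\<lambda>i\<in>I. r * x i) i / r) = restrict x I"
          using True by (auto simp: fun_eq_iff)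
        also have "\<dots> = x"
          using x by (auto simp: space_PiM PiE_def extensional_restrict)
        finally have rescale: "(\<lambda>i\<in>I. (\<lambda>i\<in>I. r * x i) i / r) = x" .
        have "(\<Sum>j\<in>I. (\<lambda>i\<in>I. r * x i) j) = r * sum x I"
          by (simp add: sum_distrib_left)
        then show ?thesis
          unfolding F_def sum_distrib_left[symmetric] using rescale True
          by (auto simp: zero_less_mult_iff)
      qed
      have "(\<integral>\<^sup>+z. F z (r - sum z I) \<partial>?P)
          = ennreal (r ^ m) * (\<integral>\<^sup>+x. F (\<lambda>i\<in>I. r * x i) (r - (\<Sum>j\<in>I. (\<lambda>i\<in>I. r * x i) j)) \<partial>?P)"
        unfolding m_def using I True by (intro nn_integral_PiM_lborel_scale) auto
      also have "\<dots> = ennreal (r ^ m) * (\<integral>\<^sup>+x. (if r < 1 then 1 else 0)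
          * (if (\<forall>i\<in>I. 0 < x i) \<and> sum x I < 1 then h x else 0) \<partial>?P)"
        by (intro arg_cong2[where f="(*)"] refl nn_integral_cong) (simp add: *)
      also have "\<dots> = ?S * (if 0 < r \<and> r < 1 then ennreal (r ^ m) else 0)"
        using True by (auto simp: mult.commute)
      finally show ?thesis .
    next
      case False
      \<comment> \<open>For r at most 0 and positive z, the variable t = r - sum z is not
        positive.\<close>
      have "F z (r - sum z I) = 0" for z
      proof (cases "\<forall>i\<in>I. 0 < z i")
        case True
        then have "0 \<le> sum z I" by (intro sum_nonneg) (auto intro: less_imp_le)
        then show ?thesis using False by (auto simp: F_def)
      qed (auto simp: F_def)
      then show ?thesis using False by simp
    qed
  qed
  also have "\<dots> = ?S * K"
    unfolding K_def by (intro nn_integral_cmult) measurable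
  finally have "?S * K = ?O * K" using J_orthant by simp
  then show ?thesis
    using \<open>K \<noteq> 0\<close> K_finite by (simp add: ennreal_mult_cancel_left mult.commute[of _ K])
qed

text \<open>Here 1 / s is the last Dirichlet coordinate. Each of the n factors contributes s to the
  power -(\<alpha> i - 1), in total n minus the sum of the \<alpha> i, and the Jacobian weight 1 / s
  ^ n removes the n.\<close>

lemma dirichlet_density_simplex_map:
  fixes \<alpha> y :: "nat \<Rightarrow> real"
  assumes n: "n \<ge> 1" and y: "y \<in> positive_orthant (n - 1)"
  defines "s \<equiv> 1 + (\<Sum>i=1..n-1. y i)"
  shows "dirichlet_density n \<alpha> (\<lambda>i\<in>{1..n-1}. y i / s) * (1 / s ^ n)
    = inverted_dirichlet_density n \<alpha> y"
proof -
  have y_pos: "0 < y i" if "i \<in> {1..n-1}" for i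
    using y that by (auto simp: positive_orthant_def)
  then have "0 \<le> (\<Sum>i=1..n-1. y i)" by (intro sum_nonneg) (auto intro: less_imp_le)
  then have s: "0 < s" by (simp add: s_def)
  have sum: "(\<Sum>i=1..n-1. (\<lambda>i\<in>{1..n-1}. y i / s) i) = (s - 1) / s"
    by (simp add: s_def flip: sum_divide_distrib)
  have last: "1 - (s - 1) / s = 1 / s" using s by (simp add: field_simps)
  \<comment> \<open>The factor with index n is treated apart: its base is the updated value 1 / s,
    not a quotient y i / s.\<close>
  have n_eq: "{1..n} = insert n {1..n-1}" using n by auto
  have sum_n: "(\<Sum>i=1..n. - (\<alpha> i - 1)) = - (\<alpha> n - 1) + (\<Sum>i=1..n-1. - (\<alpha> i - 1))"
    unfolding n_eq using n by (subst sum.insert) auto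
  have "(\<Prod>i=1..n. ((\<lambda>i\<in>{1..n-1}. y i / s)(n := 1 / s)) i powr (\<alpha> i - 1))
      = (1 / s) powr (\<alpha> n - 1) * (\<Prod>i=1..n-1. (y i / s) powr (\<alpha> i - 1))"
    unfolding n_eq using n by (subst prod.insert) (auto intro!: prod.cong)
  also have "(\<Prod>i=1..n-1. (y i / s) powr (\<alpha> i - 1))
      = (\<Prod>i=1..n-1. y i powr (\<alpha> i - 1)) * (\<Prod>i=1..n-1. s powr (- (\<alpha> i - 1)))"
    unfolding prod.distrib[symmetric]
    using y_pos s by (intro prod.cong) (auto simp: powr_divide powr_minus_divide powr_diff field_simps less_imp_le)
  also have "(\<Prod>i=1..n-1. s powr (- (\<alpha> i - 1))) = s powr (\<Sum>i=1..n-1. - (\<alpha> i - 1))"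
    using s by (intro powr_sum[symmetric]) auto
  also have "(1 / s) powr (\<alpha> n - 1) = s powr (- (\<alpha> n - 1))"
    by (simp only: powr_minus_divide powr_divide powr_one_eq_one)
  finally have prod: "(\<Prod>i=1..n. ((\<lambda>i\<in>{1..n-1}. y i / s)(n := 1 / s)) i powr (\<alpha> i - 1))
      = (\<Prod>i=1..n-1. y i powr (\<alpha> i - 1)) * s powr (\<Sum>i=1..n. - (\<alpha> i - 1))"
    by (simp only: sum_n powr_add mult_ac)
  have "(\<Sum>i=1..n. - (\<alpha> i - 1)) = real n - (\<Sum>i=1..n. \<alpha> i)"
    by (simp add: sum_subtractf)
  then have pow: "s powr (\<Sum>i=1..n. - (\<alpha> i - 1)) * (1 / s ^ n) = s powr (- (\<Sum>i=1..n. \<alpha> i))"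
    using s by (simp add: powr_diff powr_realpow powr_minus_divide)
  have "(\<lambda>i\<in>{1..n-1}. y i / s) \<in> open_simplex (n - 1)"
    unfolding open_simplex_def mem_Collect_eq sum using y_pos s by (auto simp: field_simps)
  then have "dirichlet_density n \<alpha> (\<lambda>i\<in>{1..n-1}. y i / s)
      = 1 / multi_Beta n \<alpha> * ((\<Prod>i=1..n-1. y i powr (\<alpha> i - 1)) * s powr (\<Sum>i=1..n. - (\<alpha> i - 1)))"
    unfolding dirichlet_density_def Let_def sum last prod by simp
  then have "dirichlet_density n \<alpha> (\<lambda>i\<in>{1..n-1}. y i / s) * (1 / s ^ n)
      = 1 / multi_Beta n \<alpha> * (\<Prod>i=1..n-1. y i powr (\<alpha> i - 1))
        * (s powr (\<Sum>i=1..n. - (\<alpha> i - 1)) * (1 / s ^ n))"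
    by (simp only: mult.assoc)
  then show ?thesis
    unfolding pow using y by (simp add: inverted_dirichlet_density_def s_def)
qed

lemma borel_measurable_inverted_dirichlet_density [measurable]:
  "inverted_dirichlet_density n \<alpha> \<in> borel_measurable (\<Pi>\<^sub>M i\<in>{1..n-1}. lborel)"
proof -
  \<comment> \<open>\<open>positive_orthant\<close> also contains functions outside the space of the
    product measure, so it is not itself a measurable set there. The finite conjunction is a
    measurable predicate on that space.\<close>
  have "(\<lambda>y. indicator (positive_orthant (n - 1)) y :: real)
      = (\<lambda>y. if \<forall>i\<in>{1..n-1}. 0 < y i then 1 else 0)"
    by (auto simp: fun_eq_iff positive_orthant_def)
  then show ?thesis
    unfolding inverted_dirichlet_density_def[abs_def] by simp
qed

theorem mainTheorem1:
  fixes M :: "'a measure" and n :: nat and \<alpha> :: "nat \<Rightarrow> real" and X :: "nat \<Rightarrow> 'a \<Rightarrow> real"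
  assumes "prob_space M"
    and "n \<ge> 2"
    and "\<And>i. i \<in> {1..n} \<Longrightarrow> \<alpha> i > 0"
    and "dirichlet_distributed M n \<alpha> X"
  shows "inverted_dirichlet_distributed M n \<alpha> (\<lambda>i \<omega>. X i \<omega> / X n \<omega>)"
proof -
  note One_nat_def [simp del]
  let ?I = "{1..n-1}"
  let ?P = "\<Pi>\<^sub>M i\<in>?I. lborel :: real measure"
  let ?f = "\<lambda>x. ennreal (dirichlet_density n \<alpha> x)"
  let ?g = "\<lambda>y. ennreal (inverted_dirichlet_density n \<alpha> y)"
  define X' where "X' = (\<lambda>\<omega>. \<lambda>i\<in>?I. X i \<omega>)"
  \<comment> \<open>\<open>T\<close> and \<open>S\<close> are inverse bijections between simplex and
    orthant. \<open>T\<close> turns the first n - 1 coordinates into the ratios, the denominator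
    being the last coordinate.\<close>
  define T where "T x = (\<lambda>i\<in>?I. x i / (1 - sum x ?I))" for x :: "nat \<Rightarrow> real"
  define S where "S y = (\<lambda>i\<in>?I. y i / (1 + sum y ?I))" for y :: "nat \<Rightarrow> real"
  have n_eq: "{1..n} = insert n ?I" using \<open>n \<ge> 2\<close> by auto
  have X: "X i \<in> borel_measurable M" if "i \<in> {1..n}" for i
    using assms(4) that by (auto simp: dirichlet_distributed_def)
  have X_sum: "AE \<omega> in M. (\<Sum>i=1..n. X i \<omega>) = 1"
    using assms(4) by (auto simp: dirichlet_distributed_def)
  have dist: "distributed M ?P X' ?f"
    using assms(4) by (auto simp: dirichlet_distributed_def X'_def)
  note [measurable] = distributed_measurable[OF dist] distributed_borel_measurable[OF dist]
  have T[measurable]: "T \<in> measurable ?P ?P" unfolding T_def by measurable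
  have Y[measurable]: "(\<lambda>\<omega>. \<lambda>i\<in>?I. X i \<omega> / X n \<omega>) \<in> measurable M ?P"
    using X \<open>n \<ge> 2\<close> by (intro measurable_restrict) auto
  \<comment> \<open>Only almost sure equality is available, since the coordinates sum to 1 only
    almost surely; this suffices for equality of the laws.\<close>
  have "AE \<omega> in M. (\<lambda>i\<in>?I. X i \<omega> / X n \<omega>) = T (X' \<omega>)"
    using X_sum
  proof eventually_elim
    case (elim \<omega>)
    then have "X n \<omega> = 1 - sum (X' \<omega>) ?I"
      unfolding n_eq using \<open>n \<ge> 2\<close> by (subst (asm) sum.insert) (auto simp: X'_def)
    then show ?case by (auto simp: T_def X'_def fun_eq_iff)
  qed
  then have "distr M ?P (\<lambda>\<omega>. \<lambda>i\<in>?I. X i \<omega> / X n \<omega>) = distr M ?P (\<lambda>\<omega>. T (X' \<omega>))"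
    by (intro distr_cong_AE refl Y) measurable
  also have "\<dots> = distr (distr M ?P X') ?P T"
    by (subst distr_distr) (auto simp: comp_def)
  also have "\<dots> = distr (density ?P ?f) ?P T"
    using distributed_distr_eq_density[OF dist] by simp
  also have "\<dots> = density ?P ?g"
  proof (rule measure_eqI)
    fix A assume "A \<in> sets (distr (density ?P ?f) ?P T)"
    then have A[measurable]: "A \<in> sets ?P" by simp
    have *: "indicator (T -` A \<inter> space ?P) x = (indicator A (T x) :: ennreal)" if "x \<in> space ?P" for x
      using that by (auto simp: indicator_def)
    have "emeasure (distr (density ?P ?f) ?P T) A = (\<integral>\<^sup>+x. ?f x * indicator A (T x) \<partial>?P)"
      by (auto simp: emeasure_distr emeasure_density * intro!: nn_integral_cong)
    \<comment> \<open>The density vanishes off the simplex, so the case distinction changes nothing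
      and gives the integral the form required for the change of variables.\<close>
    also have "\<dots> = (\<integral>\<^sup>+x. (if (\<forall>i\<in>?I. 0 < x i) \<and> sum x ?I < 1
        then ?f x * indicator A (T x) else 0) \<partial>?P)"
      by (intro nn_integral_cong) (auto simp: dirichlet_density_def open_simplex_def indicator_def Let_def)
    also have "\<dots> = (\<integral>\<^sup>+y. (if \<forall>i\<in>?I. 0 < y i
        then ?f (S y) * indicator A (T (S y)) * ennreal (1 / (1 + sum y ?I) ^ (card ?I + 1)) else 0) \<partial>?P)"
      unfolding S_def by (intro nn_integral_simplex_eq_orthant) auto
    also have "\<dots> = (\<integral>\<^sup>+y. ?g y * indicator A y \<partial>?P)"
    proof (intro nn_integral_cong)
      fix y :: "nat \<Rightarrow> real" assume y: "y \<in> space ?P"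
      show "(if \<forall>i\<in>?I. 0 < y i
          then ?f (S y) * indicator A (T (S y)) * ennreal (1 / (1 + sum y ?I) ^ (card ?I + 1)) else 0)
        = ?g y * indicator A y"
      proof (cases "\<forall>i\<in>?I. 0 < y i")
        case True
        then have "0 \<le> sum y ?I" by (intro sum_nonneg) (auto intro: less_imp_le)
        then have s: "0 < 1 + sum y ?I" by simp
        have "sum (S y) ?I = sum y ?I / (1 + sum y ?I)"
          by (simp add: S_def flip: sum_divide_distrib)
        then have "1 - sum (S y) ?I = 1 / (1 + sum y ?I)" using s by (simp add: field_simps)
        then have "T (S y) = restrict y ?I"
          using s by (auto simp: T_def S_def fun_eq_iff)
        \<comment> \<open>Points of the product space are extensional, so \<open>restrict\<close>
          leaves y fixed. This turns the event T (S y) in A into y in A.\<close>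
        then have TS: "T (S y) = y"
          using y by (auto simp: space_PiM PiE_def extensional_restrict)
        have "?f (S y) * ennreal (1 / (1 + sum y ?I) ^ n) = ?g y"
          using dirichlet_density_simplex_map[of n y \<alpha>] True s \<open>n \<ge> 2\<close>
          by (subst ennreal_mult''[symmetric]) (auto simp: S_def positive_orthant_def)
        \<comment> \<open>Matches the exponent of the weight with the power s ^ n cancelled in
          \<open>dirichlet_density_simplex_map\<close>.\<close>
        moreover have "card ?I + 1 = n" using \<open>n \<ge> 2\<close> by simp
        ultimately show ?thesis using True TS by (simp add: mult_ac)
      qed (auto simp: inverted_dirichlet_density_def positive_orthant_def)
    qed
    also have "\<dots> = emeasure (density ?P ?g) A"
      by (subst emeasure_density) auto
    finally show "emeasure (distr (density ?P ?f) ?P T) A = emeasure (density ?P ?g) A" .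
  qed simp
  finally show ?thesis
    using Y by (auto simp: inverted_dirichlet_distributed_def distributed_def)
qed

end
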